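(* For every positive integer $n$, the matrix $n\,G_n^{-1}$ has integer entries, where $G_n := V_n^*\,V_n$ is the Gram matrix of the Vandermonde matrix $V_n$ associated with the $n$th cyclotomic polynomial.
   Context: For a positive integer $n$, let $m := \varphi(n)$ (Euler's totient function) and let $\zeta_1, \dots, \zeta_m \in \mathbb{C}$ be the primitive $n$th roots of unity (listed in any fixed order). The Vandermonde matrix associated with the $n$th cyclotomic polynomial is the $m \times m$ complex matrix $V_n := (\zeta_i^{\,j-1})_{1 \leq i,j \leq m}$; it is invertible since the $\zeta_i$ are distinct. $V_n^*$ denotes the conjugate transpose of $V_n$, and $G_n := V_n^*\,V_n$, which is an invertible $m \times m$ matrix. *)

theory Defs
  imports
    "HOL-Number_Theory.Totient"
    "Jordan_Normal_Form.Schur_Decomposition"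
begin

definition primitive_unity_roots :: "nat \<Rightarrow> complex set" where
  "primitive_unity_roots n = {z. z ^ n = 1 \<and> (\<forall>k. 0 < k \<and> k < n \<longrightarrow> z ^ k \<noteq> 1)}"

text \<open>
  Matrix indices start at 0, so the entry \<open>\<zeta>\<^sub>i\<^bsup>j-1\<^esup>\<close> of the usual 1-based description is
  \<open>\<zeta> i ^ j\<close> here, where \<open>\<zeta> 0, \<dots>, \<zeta> (totient n - 1)\<close> is meant to enumerate the primitive
  \<open>n\<close>th roots of unity.
\<close>
definition cyclotomic_vandermonde :: "nat \<Rightarrow> (nat \<Rightarrow> complex) \<Rightarrow> complex mat" where
  "cyclotomic_vandermonde n \<zeta> = mat (totient n) (totient n) (\<lambda>(i, j). \<zeta> i ^ j)"

definition cyclotomic_gram :: "nat \<Rightarrow> (nat \<Rightarrow> complex) \<Rightarrow> complex mat" where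
  "cyclotomic_gram n \<zeta> =
     mat_adjoint (cyclotomic_vandermonde n \<zeta>) * cyclotomic_vandermonde n \<zeta>"

end

theory Submission
  imports Defs "HOL-Computational_Algebra.Fundamental_Theorem_Algebra"
begin

text \<open>
  Write \<open>x\<^sup>n - 1 = \<Phi> \<Psi>\<close>, where \<open>\<Phi>\<close> is the \<open>n\<close>th cyclotomic polynomial; both factors have integer
  coefficients. The columns of the inverse of \<open>V\<close> are the coefficient vectors of the Lagrange
  polynomials \<open>\<Phi>(x) / ((x - \<zeta>) \<Phi>'(\<zeta>))\<close>. Differentiating the factorization at \<open>\<zeta>\<close> gives
  \<open>n / \<Phi>'(\<zeta>) = \<zeta> \<Psi>(\<zeta>)\<close>, so the \<open>j\<close>th coefficient is \<open>c\<^sub>j(\<zeta>) / n\<close> with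
  \<open>c\<^sub>j\<close> an integer polynomial divisible by \<open>\<Psi>\<close>. Hence the \<open>(j, k)\<close> entry of \<open>n\<close> times the inverse Gram
  matrix is \<open>1/n\<close> times the sum of \<open>c\<^sub>j(\<zeta>)\<close> times the conjugate of \<open>c\<^sub>k(\<zeta>)\<close>. As \<open>\<Psi>\<close> vanishes at
  the non-primitive roots, this sum may be taken over all \<open>n\<close>th roots of unity, where the average of
  an integer polynomial is an integer.
\<close>

section \<open>Quotients by a linear factor\<close>

text \<open>Horner's scheme: for \<open>p\<close> with coefficients a_i, both sides are the sum of
  a_i c^(i-j-1) over i > j. Each coefficient of the quotient thus becomes a polynomial in the root
  \<open>c\<close>, with coefficients taken from \<open>p\<close>.\<close>

lemma coeff_synthetic_div:
  "coeff (synthetic_div p c) j = poly (poly_shift (Suc j) p) c"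
proof (induction p arbitrary: j)
  case 0
  then show ?case by simp
next
  case (pCons a p)
  have "poly_shift (Suc j) (pCons a p) = poly_shift j p" for j
    by (simp add: poly_eq_iff coeff_poly_shift)
  with pCons show ?case
    by (cases j) simp_all
qed

lemma of_int_poly_shift:
  "poly_shift k (of_int_poly p) = of_int_poly (poly_shift k p)"
  by (simp add: poly_eq_iff coeff_poly_shift)

section \<open>Cyclotomic factorization of x^n - 1\<close>

lemma prod_nth_roots_unity:
  assumes "n > 0"
  shows "(\<Prod>z | z ^ n = 1. [:-z, 1:]) = (monom 1 n - 1 :: complex poly)"
proof -
  define p :: "complex poly" where "p = monom 1 n - 1"
  have "degree (- 1 + monom 1 n :: complex poly) = degree (monom 1 n :: complex poly)"
    using assms by (intro degree_add_eq_right) (simp add: degree_monom_eq)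
  then have "degree p = n"
    by (simp add: p_def degree_monom_eq)
  then have lc: "lead_coeff p = 1"
    using assms by (simp add: p_def)
  \<comment> \<open>The derivative n x^(n-1) can vanish only at 0, which is not a root of
    \<open>p\<close>.\<close>
  have "rsquarefree p"
    using assms
    by (auto simp: rsquarefree_roots p_def poly_monom pderiv_diff pderiv_monom power_0_left)
  then have "smult (lead_coeff p) (\<Prod>z | poly p z = 0. [:-z, 1:]) = p"
    by (rule complex_poly_decompose_rsquarefree)
  then show ?thesis
    unfolding lc by (simp add: p_def poly_monom)
qed

lemma power_eq_one_dvd:
  fixes z :: complex
  assumes "z \<in> primitive_unity_roots d" and "z ^ n = 1" and "d > 0"
  shows "d dvd n"
proof -
  have "z ^ n = (z ^ d) ^ (n div d) * z ^ (n mod d)"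
    by (metis mult_div_mod_eq power_add power_mult)
  then have "z ^ (n mod d) = 1"
    using assms by (simp add: primitive_unity_roots_def)
  moreover have "n mod d < d"
    using assms by simp
  ultimately show ?thesis
    using assms by (auto simp: primitive_unity_roots_def dvd_eq_mod_eq_0)
qed

lemma roots_unity_eq_Union_primitive:
  assumes "n > 0"
  shows "{z. z ^ n = 1} = (\<Union>d \<in> {d. d dvd n}. primitive_unity_roots d)"
proof (intro equalityI subsetI)
  fix z :: complex
  assume "z \<in> {z. z ^ n = 1}"
  then have z: "z ^ n = 1" by simp
  define d where "d = (LEAST d. d > 0 \<and> z ^ d = 1)"
  have "d > 0 \<and> z ^ d = 1"
    unfolding d_def by (rule LeastI[where k = n]) (use z assms in simp)
  moreover have "\<not> (k > 0 \<and> z ^ k = 1)" if "k < d" for k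
    using not_less_Least[of k] that unfolding d_def by blast
  ultimately have d: "d > 0" "z \<in> primitive_unity_roots d"
    by (auto simp: primitive_unity_roots_def)
  with power_eq_one_dvd[OF d(2) z d(1)] show "z \<in> (\<Union>d \<in> {d. d dvd n}. primitive_unity_roots d)"
    by blast
qed (auto simp: primitive_unity_roots_def power_mult dvd_def)

lemma primitive_unity_roots_disjoint:
  assumes "z \<in> primitive_unity_roots d" "z \<in> primitive_unity_roots e" "d > 0" "e > 0"
  shows "d = e"
  using assms power_eq_one_dvd[of z] by (intro dvd_antisym) (auto simp: primitive_unity_roots_def)

lemma finite_roots_unity_complex: "n > 0 \<Longrightarrow> finite {z :: complex. z ^ n = 1}"
  by (rule finite_roots_unity) simp

lemma finite_primitive_unity_roots: "n > 0 \<Longrightarrow> finite (primitive_unity_roots n)"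
  by (rule finite_subset[OF _ finite_roots_unity_complex[of n]])
    (auto simp: primitive_unity_roots_def)

definition cyclotomic :: "nat \<Rightarrow> complex poly" where
  "cyclotomic n = (\<Prod>z \<in> primitive_unity_roots n. [:-z, 1:])"

text \<open>For positive \<open>n\<close> this is the quotient of x^n - 1 by
  \<open>cyclotomic n\<close>. As a product over proper divisors it inherits integrality from
  smaller indices.\<close>

definition cyclotomic_cofactor :: "nat \<Rightarrow> complex poly" where
  "cyclotomic_cofactor n = (\<Prod>d | d dvd n \<and> d \<noteq> n. cyclotomic d)"

lemma cyclotomic_mult_cofactor:
  assumes "n > 0"
  shows "cyclotomic n * cyclotomic_cofactor n = monom 1 n - 1"
proof -
  have fin: "finite {d. d dvd n}"
    using assms by (rule finite_divisors_nat)
  have "(\<Prod>z | z ^ n = 1. [:-z, 1:]) = (\<Prod>d | d dvd n. cyclotomic d)"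
    unfolding roots_unity_eq_Union_primitive[OF assms] cyclotomic_def
  proof (rule prod.UNION_disjoint)
    show "\<forall>d \<in> {d. d dvd n}. finite (primitive_unity_roots d)"
      using assms finite_primitive_unity_roots dvd_pos_nat by blast
    have "d = e" if "d dvd n" "e dvd n" "z \<in> primitive_unity_roots d" "z \<in> primitive_unity_roots e"
      for d e z
      using that assms by (intro primitive_unity_roots_disjoint) (auto dest: dvd_pos_nat)
    then show "\<forall>d \<in> {d. d dvd n}. \<forall>e \<in> {d. d dvd n}. d \<noteq> e \<longrightarrow>
        primitive_unity_roots d \<inter> primitive_unity_roots e = {}"
      by blast
  qed (fact fin)
  also have "\<dots> = cyclotomic n * (\<Prod>d \<in> {d. d dvd n} - {n}. cyclotomic d)"
    by (rule prod.remove[OF fin]) simp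
  also have "{d. d dvd n} - {n} = {d. d dvd n \<and> d \<noteq> n}"
    by auto
  finally show ?thesis
    by (simp add: prod_nth_roots_unity[OF assms] cyclotomic_cofactor_def)
qed

lemma poly_cyclotomic_eq_0_iff:
  "n > 0 \<Longrightarrow> poly (cyclotomic n) z = 0 \<longleftrightarrow> z \<in> primitive_unity_roots n"
  by (auto simp: cyclotomic_def poly_prod finite_primitive_unity_roots)

lemma poly_cyclotomic_cofactor_eq_0:
  assumes "n > 0" "z ^ n = 1" "z \<notin> primitive_unity_roots n"
  shows "poly (cyclotomic_cofactor n) z = 0"
proof -
  have "poly (cyclotomic n) z * poly (cyclotomic_cofactor n) z = 0"
    using assms by (simp flip: poly_mult add: cyclotomic_mult_cofactor poly_monom)
  with assms show ?thesis
    by (simp add: poly_cyclotomic_eq_0_iff)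
qed

lemma monic_cyclotomic: "lead_coeff (cyclotomic n) = 1"
  by (simp add: cyclotomic_def lead_coeff_prod)

lemma degree_cyclotomic: "degree (cyclotomic n) = card (primitive_unity_roots n)"
  by (simp add: cyclotomic_def degree_prod_eq_sum_degree)

lemma monic_cyclotomic_cofactor: "lead_coeff (cyclotomic_cofactor n) = 1"
  by (simp add: cyclotomic_cofactor_def lead_coeff_prod monic_cyclotomic)

section \<open>Integrality of the cyclotomic polynomials\<close>

text \<open>Division by a monic \<open>g\<close> stays within the integers: f = g s + r. Then g (q -
  s) = r, and unless q = s the left side is nonzero of degree at least that of \<open>g\<close>, too
  large for a remainder.\<close>

lemma int_quotient_by_monic:
  fixes f g :: "int poly" and q :: "'a :: {idom, ring_char_0} poly"
  assumes "of_int_poly f = of_int_poly g * q" and "lead_coeff g = 1"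
  shows "q \<in> range of_int_poly"
proof -
  from assms(2) have "g \<noteq> 0" by auto
  obtain s r where sr: "pseudo_divmod f g = (s, r)"
    by fastforce
  \<comment> \<open>Pseudo-division scales \<open>f\<close> by a power of the leading coefficient of
    \<open>g\<close>, here 1, so it is ordinary division.\<close>
  have f: "f = g * s + r" and r: "r = 0 \<or> degree r < degree g"
    using pseudo_divmod[OF \<open>g \<noteq> 0\<close> sr] assms(2) by simp_all
  have eq: "of_int_poly g * (q - of_int_poly s) = (of_int_poly r :: 'a poly)"
    using assms(1) by (simp add: f of_int_poly_hom.hom_mult of_int_poly_hom.hom_add algebra_simps)
  have "q - of_int_poly s = 0"
  proof (rule ccontr)
    assume *: "q - of_int_poly s \<noteq> 0"
    have "degree (of_int_poly g * (q - of_int_poly s)) \<ge> degree g"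
      using * \<open>g \<noteq> 0\<close> by (subst degree_mult_eq) auto
    moreover have "of_int_poly r \<noteq> (0 :: 'a poly)"
      using * \<open>g \<noteq> 0\<close> unfolding eq[symmetric] by simp
    ultimately show False
      using r unfolding eq by auto
  qed
  then show ?thesis by simp
qed

lemma of_int_poly_prod_range:
  assumes "\<And>x. x \<in> A \<Longrightarrow> f x \<in> range of_int_poly"
  shows "prod f A \<in> range (of_int_poly :: _ \<Rightarrow> 'a :: comm_ring_1 poly)"
  using assms
proof (induction A rule: infinite_finite_induct)
  case (insert x A)
  then obtain p q where "f x = of_int_poly p" "prod f A = of_int_poly q"
    by (meson image_iff insertCI)
  with insert.hyps have "prod f (insert x A) = of_int_poly (p * q)"
    by (simp add: of_int_poly_hom.hom_mult)
  then show ?case by (rule range_eqI)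
qed (auto intro!: range_eqI[of _ _ 1])

text \<open>Strong induction: the cofactor is integral by the hypothesis for proper divisors, and it
  is monic, so dividing x^n - 1 by it stays integral.\<close>

lemma cyclotomic_int: "n > 0 \<Longrightarrow> cyclotomic n \<in> range of_int_poly"
proof (induction n rule: less_induct)
  case (less n)
  have "cyclotomic_cofactor n \<in> range of_int_poly"
    unfolding cyclotomic_cofactor_def
    using less by (intro of_int_poly_prod_range less.IH)
      (auto intro: dvd_pos_nat le_neq_implies_less dvd_imp_le)
  then obtain g where g: "cyclotomic_cofactor n = of_int_poly g"
    by auto
  have "of_int_poly (monom 1 n - 1) = of_int_poly g * cyclotomic n"
    using cyclotomic_mult_cofactor[OF less.prems]
    by (simp add: g mult.commute of_int_poly_hom.hom_minus)
  moreover have "lead_coeff g = 1"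
    using monic_cyclotomic_cofactor[of n] unfolding g by simp
  ultimately show ?case
    by (rule int_quotient_by_monic)
qed

lemma cyclotomic_cofactor_int: "n > 0 \<Longrightarrow> cyclotomic_cofactor n \<in> range of_int_poly"
  unfolding cyclotomic_cofactor_def
  by (intro of_int_poly_prod_range cyclotomic_int) (auto intro: dvd_pos_nat)

section \<open>Averages over the roots of unity\<close>

lemma sum_roots_unity_power:
  assumes "n > 0"
  shows "(\<Sum>z :: complex | z ^ n = 1. z ^ k) = (if n dvd k then of_nat n else 0)"
proof (cases "n dvd k")
  case True
  then have "(\<Sum>z :: complex | z ^ n = 1. z ^ k) = (\<Sum>z :: complex | z ^ n = 1. 1)"
    by (intro sum.cong) (auto simp: power_mult elim!: dvdE)
  with True show ?thesis
    using card_roots_unity_eq[OF assms] by simp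
next
  case False
  define S where "S = (\<Sum>z :: complex | z ^ n = 1. z ^ k)"
  \<comment> \<open>A primitive \<open>n\<close>th root of unity: multiplication by \<open>w\<close>
    permutes the summation range and scales \<open>S\<close> by \<open>w ^ k\<close>, which differs
    from 1.\<close>
  define w where "w = cis (2 * pi / n)"
  have wn: "w ^ n = 1"
    using assms by (simp add: w_def DeMoivre)
  have wk: "w ^ k \<noteq> 1"
  proof
    assume "w ^ k = 1"
    then have "cis (2 * pi * real k / real n) = 1"
      by (simp add: w_def DeMoivre mult_ac)
    then obtain m :: int where "2 * pi * real k / real n = 2 * pi * m"
      by (auto simp: complex_eq_iff cos_one_2pi_int)
    then have "real k = real n * m"
      using assms by (simp add: field_simps)
    then have "int k = int n * m"
      by (metis of_int_eq_iff of_int_mult of_int_of_nat_eq)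
    then show False
      using False by (metis dvd_triv_left int_dvd_int_iff)
  qed
  have [simp]: "w \<noteq> 0"
    by (simp add: w_def)
  have "S = (\<Sum>z :: complex | z ^ n = 1. (w * z) ^ k)"
    unfolding S_def
    by (rule sum.reindex_bij_witness[of _ "\<lambda>z. w * z" "\<lambda>z. z / w"])
      (auto simp: wn power_divide power_mult_distrib)
  also have "\<dots> = w ^ k * S"
    by (simp add: S_def power_mult_distrib sum_distrib_left)
  finally have "S = 0"
    using wk by simp
  with False show ?thesis
    by (simp add: S_def)
qed

text \<open>Only exponents divisible by \<open>n\<close> survive, each contributing \<open>n\<close>
  times an integer.\<close>

lemma sum_poly_roots_unity_int:
  assumes "n > 0"
  shows "(\<Sum>z | z ^ n = 1. poly (of_int_poly p) z) / of_nat n \<in> (\<int> :: complex set)"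
proof -
  have "(\<Sum>z :: complex | z ^ n = 1. poly (of_int_poly p) z)
      = (\<Sum>i\<le>degree p. \<Sum>z | z ^ n = 1. of_int (coeff p i) * z ^ i)"
    by (simp add: poly_altdef sum.swap[of _ _ "{z. z ^ n = 1}"])
  also have "\<dots> = (\<Sum>i\<le>degree p. of_int (coeff p i) * (if n dvd i then of_nat n else 0))"
    by (simp add: sum_roots_unity_power[OF assms] flip: sum_distrib_left)
  finally show ?thesis
    using assms by (auto simp: sum_divide_distrib intro!: Ints_sum)
qed

lemma cnj_root_unity:
  assumes "n > 0" "z ^ n = 1"
  shows "cnj z = z ^ (n - 1)"
proof -
  have "norm z = 1"
    using assms by (metis power_eq_1_iff less_not_refl)
  then have "cnj z * z = 1"
    by (metis complex_norm_square mult.commute of_real_1 power_one)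
  moreover have "z ^ (n - 1) * z = 1"
    using assms by (simp flip: power_Suc2)
  ultimately show ?thesis
    by (metis mult_cancel_right mult_zero_right zero_neq_one)
qed

lemma cnj_poly_of_int: "cnj (poly (of_int_poly p) z) = poly (of_int_poly p) (cnj z)"
  by (simp add: poly_altdef)

lemma sum_poly_cnj_roots_unity_int:
  assumes "n > 0"
  shows "(\<Sum>z | z ^ n = 1. poly (of_int_poly p) z * cnj (poly (of_int_poly q) z)) / of_nat n \<in> \<int>"
proof -
  \<comment> \<open>On the roots of unity conjugation is the power map with exponent n - 1, so
    composing \<open>q\<close> with that power absorbs it into an integer polynomial.\<close>
  let ?r = "p * pcompose q (monom 1 (n - 1))"
  have "poly (of_int_poly p) z * cnj (poly (of_int_poly q) z) = poly (of_int_poly ?r) z"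
    if "z ^ n = 1" for z :: complex
    by (simp add: cnj_poly_of_int cnj_root_unity[OF assms that] of_int_poly_hom.hom_mult
        of_int_hom.map_poly_pcompose poly_pcompose poly_monom)
  then show ?thesis
    using sum_poly_roots_unity_int[OF assms, of ?r] by simp
qed

section \<open>Adjoints and the inverse of a Gram matrix\<close>

lemma mat_adjoint_index:
  "i < dim_col A \<Longrightarrow> j < dim_row A \<Longrightarrow> mat_adjoint A $$ (i, j) = conjugate (A $$ (j, i))"
  by (simp add: mat_adjoint_def mat_of_rows_def)

lemma dim_mat_adjoint [simp]:
  "dim_row (mat_adjoint A) = dim_col A" "dim_col (mat_adjoint A) = dim_row A"
  by (simp_all add: mat_adjoint_def)

lemma mat_adjoint_carrier: "A \<in> carrier_mat r c \<Longrightarrow> mat_adjoint A \<in> carrier_mat c r"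
  by (intro carrier_matI) auto

lemma mat_adjoint_mult_complex:
  fixes A B :: "complex mat"
  assumes "dim_col A = dim_row B"
  shows "mat_adjoint (A * B) = mat_adjoint B * mat_adjoint A"
  using assms
  by (intro eq_matI) (simp_all add: mat_adjoint_index scalar_prod_def mult.commute)

lemma mat_adjoint_one_complex: "mat_adjoint (1\<^sub>m m :: complex mat) = 1\<^sub>m m"
  by (intro eq_matI) (auto simp: mat_adjoint_index)

text \<open>The inner product \<open>V * W\<close> cancels, leaving the adjoint of
  \<open>W * V\<close>. This is the identity too, since a one-sided inverse of a square matrix is
  two-sided.\<close>

lemma gram_inverse:
  fixes V W :: "complex mat"
  assumes V: "V \<in> carrier_mat m m" and W: "W \<in> carrier_mat m m" and VW: "V * W = 1\<^sub>m m"
  shows "inverts_mat (mat_adjoint V * V) (W * mat_adjoint W)"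
    and "inverts_mat (W * mat_adjoint W) (mat_adjoint V * V)"
proof -
  note carrier = V W mat_adjoint_carrier[OF V] mat_adjoint_carrier[OF W]
  have WV: "W * V = 1\<^sub>m m"
    by (rule mat_mult_left_right_inverse[OF V W VW])
  have "mat_adjoint V * V * (W * mat_adjoint W) = mat_adjoint V * (V * W * mat_adjoint W)"
    using carrier by (simp add: assoc_mult_mat[of _ m m _ m _ m])
  also have "\<dots> = mat_adjoint (W * V)"
    using carrier by (simp add: VW mat_adjoint_mult_complex)
  finally have *: "mat_adjoint V * V * (W * mat_adjoint W) = 1\<^sub>m m"
    by (simp add: WV mat_adjoint_one_complex)
  then show "inverts_mat (mat_adjoint V * V) (W * mat_adjoint W)"
    using V by (simp add: inverts_mat_def)
  show "inverts_mat (W * mat_adjoint W) (mat_adjoint V * V)"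
    using mat_mult_left_right_inverse[OF _ _ *] carrier W by (simp add: inverts_mat_def)
qed

section \<open>The inverse Vandermonde matrix and integrality of the scaled inverse Gram
  matrix\<close>

text \<open>
  The integer polynomial \<open>c\<^sub>j\<close>: evaluated at \<open>z\<close>, the shifted polynomial yields the \<open>j\<close>th
  coefficient of \<open>\<Phi>(x) / (x - z)\<close>.
\<close>
definition dual_coeff :: "nat \<Rightarrow> nat \<Rightarrow> complex poly" where
  "dual_coeff n j = monom 1 1 * cyclotomic_cofactor n * poly_shift (Suc j) (cyclotomic n)"

lemma dual_coeff_int: "n > 0 \<Longrightarrow> dual_coeff n j \<in> range of_int_poly"
proof -
  assume "n > 0"
  then obtain p q where "cyclotomic n = of_int_poly p" "cyclotomic_cofactor n = of_int_poly q"
    using cyclotomic_int cyclotomic_cofactor_int by blast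
  then have "dual_coeff n j = of_int_poly (monom 1 1 * q * poly_shift (Suc j) p)"
    by (simp add: dual_coeff_def of_int_poly_shift of_int_poly_hom.hom_mult)
  then show ?thesis by (rule range_eqI)
qed

lemma poly_dual_coeff_eq_0:
  "n > 0 \<Longrightarrow> z ^ n = 1 \<Longrightarrow> z \<notin> primitive_unity_roots n \<Longrightarrow> poly (dual_coeff n j) z = 0"
  by (simp add: dual_coeff_def poly_cyclotomic_cofactor_eq_0)

text \<open>Up to the factor \<open>n\<close>, this is an entry of the Vandermonde matrix times its
  inverse. The sum is z \<Psi>(z) q(w) with q = \<Phi> / (x - z), and q vanishes at every primitive
  root other than \<open>z\<close>.\<close>

lemma sum_power_dual_coeff:
  assumes n: "n > 0" and w: "w \<in> primitive_unity_roots n" and z: "z \<in> primitive_unity_roots n"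
  shows "(\<Sum>j<card (primitive_unity_roots n). w ^ j * poly (dual_coeff n j) z)
    = (if w = z then of_nat n else 0)"
proof -
  define q where "q = synthetic_div (cyclotomic n) z"
  define m where "m = card (primitive_unity_roots n)"
  have "m > 0"
    unfolding m_def using w finite_primitive_unity_roots[OF n] card_gt_0_iff by blast
  \<comment> \<open>The degree of \<open>q\<close> is m - 1 in truncated subtraction, so the ranges
    agree only because \<open>m > 0\<close>.\<close>
  then have deg: "{..<m} = {..degree q}"
    by (auto simp: q_def degree_synthetic_div degree_cyclotomic m_def)
  have fac: "cyclotomic n = [:-z, 1:] * q"
    using synthetic_div_correct'[of z "cyclotomic n"] poly_cyclotomic_eq_0_iff[OF n, of z] z
    by (simp add: q_def)
  have eq: "(\<Sum>j<m. w ^ j * poly (dual_coeff n j) z)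
      = z * poly (cyclotomic_cofactor n) z * poly q w"
    unfolding deg poly_altdef[of q]
    by (simp add: dual_coeff_def q_def coeff_synthetic_div poly_monom sum_distrib_left mult_ac)
  show ?thesis
  proof (cases "w = z")
    case False
    have "poly (cyclotomic n) w = 0"
      using poly_cyclotomic_eq_0_iff[OF n] w by simp
    then have "poly q w = 0"
      using False unfolding fac by simp
    with False eq show ?thesis
      by (simp add: m_def)
  next
    case True
    \<comment> \<open>In the product rule, the summand that keeps the factor x - z vanishes at
      \<open>z\<close>.\<close>
    have "poly (pderiv (cyclotomic n * cyclotomic_cofactor n)) z
        = poly q z * poly (cyclotomic_cofactor n) z"
      unfolding fac mult.assoc[of "[:-z, 1:]"] pderiv_mult[of "[:-z, 1:]"]
      by (simp add: pderiv_pCons)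
    then have "poly q z * poly (cyclotomic_cofactor n) z = of_nat n * z ^ (n - 1)"
      by (simp add: cyclotomic_mult_cofactor[OF n] pderiv_diff pderiv_monom poly_monom)
    \<comment> \<open>The factor x in \<open>dual_coeff\<close> raises z^(n-1) to z^n = 1.\<close>
    then have "z * poly (cyclotomic_cofactor n) z * poly q z = of_nat n * (z * z ^ (n - 1))"
      by (simp add: mult_ac)
    also have "\<dots> = of_nat n"
      using n z by (simp add: primitive_unity_roots_def flip: power_Suc)
    finally show ?thesis
      using True eq by (simp add: m_def)
  qed
qed

theorem theorem1p3:
  fixes n :: nat and \<zeta> :: "nat \<Rightarrow> complex"
  assumes "n > 0"
    and "bij_betw \<zeta> {..<totient n} (primitive_unity_roots n)"
  shows "\<exists>H. inverts_mat (cyclotomic_gram n \<zeta>) H \<and> inverts_mat H (cyclotomic_gram n \<zeta>) \<and>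
             elements_mat (of_nat n \<cdot>\<^sub>m H) \<subseteq> \<int>"
proof -
  define m where "m = totient n"
  define V where "V = cyclotomic_vandermonde n \<zeta>"
  \<comment> \<open>Column \<open>i\<close> holds the coefficients of the Lagrange polynomial that
    is 1 at \<open>\<zeta> i\<close> and 0 at the other primitive roots.\<close>
  define W where "W = mat m m (\<lambda>(j, i). poly (dual_coeff n j) (\<zeta> i) / of_nat n)"
  define H where "H = W * mat_adjoint W"
  have bij: "bij_betw \<zeta> {..<m} (primitive_unity_roots n)"
    using assms(2) by (simp add: m_def)
  \<comment> \<open>The enumeration itself ties the degree of the cyclotomic polynomial to the
    matrix size.\<close>
  have card: "card (primitive_unity_roots n) = m"
    using bij_betw_same_card[OF bij] by simp
  have prim: "\<zeta> i \<in> primitive_unity_roots n" if "i < m" for i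
    using bij that by (auto simp: bij_betw_def)
  have inj: "\<zeta> i = \<zeta> j \<longleftrightarrow> i = j" if "i < m" "j < m" for i j
    using bij that by (auto simp: bij_betw_def inj_on_def)
  have V: "V \<in> carrier_mat m m" and W: "W \<in> carrier_mat m m"
    by (simp_all add: V_def W_def m_def cyclotomic_vandermonde_def)
  have "V * W = 1\<^sub>m m"
  proof (rule eq_matI)
    fix i j assume "i < dim_row (1\<^sub>m m)" "j < dim_col (1\<^sub>m m)"
    then have ij: "i < m" "j < m" by simp_all
    then have "(V * W) $$ (i, j) = (\<Sum>k<m. \<zeta> i ^ k * poly (dual_coeff n k) (\<zeta> j)) / of_nat n"
      by (simp add: V_def W_def m_def cyclotomic_vandermonde_def scalar_prod_def
          sum_divide_distrib atLeast0LessThan)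
    then show "(V * W) $$ (i, j) = 1\<^sub>m m $$ (i, j)"
      using sum_power_dual_coeff[OF assms(1) prim prim, OF ij] ij inj[OF ij] assms(1)
      by (simp add: card)
  qed (use V W in auto)
  note inv = gram_inverse[OF V W this]
  have "of_nat n * H $$ (j, k) \<in> \<int>" if jk: "j < m" "k < m" for j k
  proof -
    obtain p q where pq: "dual_coeff n j = of_int_poly p" "dual_coeff n k = of_int_poly q"
      using dual_coeff_int[OF assms(1)] by blast
    let ?f = "\<lambda>z. poly (dual_coeff n j) z * cnj (poly (dual_coeff n k) z)"
    \<comment> \<open>Each factor of \<open>H\<close> brings a division by \<open>n\<close>; the
      scalar \<open>n\<close> cancels one of the two.\<close>
    have "of_nat n * H $$ (j, k) = (\<Sum>i<m. ?f (\<zeta> i)) / of_nat n"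
      using jk assms(1)
      by (simp add: H_def W_def scalar_prod_def mat_adjoint_index sum_distrib_left
          sum_divide_distrib atLeast0LessThan)
    also have "(\<Sum>i<m. ?f (\<zeta> i)) = (\<Sum>z \<in> primitive_unity_roots n. ?f z)"
      by (rule sum.reindex_bij_betw[OF bij])
    \<comment> \<open>The added terms sit at non-primitive roots, where \<open>dual_coeff\<close>
      vanishes through its cofactor.\<close>
    also have "\<dots> = (\<Sum>z | z ^ n = 1. ?f z)"
      using assms(1)
      by (intro sum.mono_neutral_left finite_roots_unity_complex)
        (auto simp: primitive_unity_roots_def poly_dual_coeff_eq_0)
    finally show ?thesis
      using sum_poly_cnj_roots_unity_int[OF assms(1)] by (simp add: pq)
  qed
  moreover have "H \<in> carrier_mat m m"
    using W mat_adjoint_carrier[OF W] by (simp add: H_def)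
  ultimately have "elements_mat (of_nat n \<cdot>\<^sub>m H) \<subseteq> \<int>"
    by (auto simp: elements_mat_def)
  with inv show ?thesis
    unfolding H_def V_def cyclotomic_gram_def by blast
qed

end
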